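(* Let $f,g_1,\ldots,g_m\in\mathbb{R}[\mathbf{x}]$, and let $d=\max\{\lceil\deg(f)/2\rceil,d_1,\ldots,d_m\}$ with $d_j=\lceil\deg(g_j)/2\rceil$. For fixed $\hat d\ge d$, the sequence $(\theta^{(k)}_{\hat d})_{k\ge1}$ of optimal values of the block moment relaxations $(\mathrm{Q}^k_{\hat d})$ is monotone nondecreasing, and in addition $\theta^{*}_{\hat d}=\theta_{\hat d}$, where $\theta^*_{\hat d}$ is the optimal value of the stabilized block moment relaxation $(\mathrm{Q}^{\mathrm{ts}}_{\hat d})$ and $\theta_{\hat d}$ is the optimal value of the dense moment relaxation $(\mathrm{Q}_{\hat d})$.
   Context: $\mathbb{N}=\{0,1,2,\ldots\}$; $\mathbb{R}[\mathbf{x}]=\mathbb{R}[x_1,\ldots,x_n]$; $\mathbb{N}^n_t=\{\alpha\in\mathbb{N}^n:\sum_i\alpha_i\le t\}$; $\mathrm{supp}(h)$ is the set of exponents with nonzero coefficient in $h$; sums of sets are Minkowski sums. The setting is the problem of minimizing $f$ over $\mathbf{K}=\{\mathbf{x}\in\mathbb{R}^n:g_j(\mathbf{x})\ge0,\ j=1,\ldots,m\}$. Put $g_0=1$, $d_0=0$. For a real sequence $\mathbf{y}=(y_\alpha)_{\alpha\in\mathbb{N}^n}$, $L_{\mathbf{y}}(\sum_\alpha h_\alpha\mathbf{x}^\alpha)=\sum_\alpha h_\alpha y_\alpha$; for $g=\sum_\alpha g_\alpha\mathbf{x}^\alpha$ the localizing matrix $M_t(g\mathbf{y})$ is indexed by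 $\mathbb{N}^n_t$ with entries $M_t(g\mathbf{y})_{\beta\gamma}=\sum_\alpha g_\alpha y_{\alpha+\beta+\gamma}$, and $M_t(\mathbf{y})=M_t(1\cdot\mathbf{y})$ is the moment matrix. $\succeq0$ means positive semidefinite, $\circ$ is the entrywise product. Dense relaxation $(\mathrm{Q}_{\hat d})$: minimize $L_{\mathbf{y}}(f)$ subject to $M_{\hat d}(\mathbf{y})\succeq0$, $M_{\hat d-d_j}(g_j\mathbf{y})\succeq0$ for $j=1,\ldots,m$, $y_{\mathbf{0}}=1$; optimal value (infimum) $\theta_{\hat d}$. Block-closure: for a symmetric binary ($\{0,1\}$-valued) matrix $B$, $\overline{B}$ is the binary matrix whose set of positions of nonzero entries is the transitive closure of the relation $\{(i,j):B_{ij}=1\}$. Iteration: let $\mathcal{A}=\mathrm{supp}(f)\cup\bigcup_{j=1}^m\mathrm{supp}(g_j)$, $\mathcal{S}^{(0)}_{0,\hat d}=\mathcal{A}\cup(2\mathbb{N})^n$, $\mathcal{S}^{(0)}_{j,\hat d}=\emptyset$ for $j=1,\ldots,m$. For $k\ge1$ and $j=0,\ldots,m$ define binary matrices indexed by $\mathbb{N}^n_{\hat d-d_j}$: (1) $[C^{(k)}_{j,\hat d}]_{\beta\gamma}=1$ if $(\mathrm{supp}(g_j)+\beta+\gamma)\cap\bigcup_{i=0}^m\mathcal{S}^{(k-1)}_{i,\hat d}\ne\emptyset$, and $0$ otherwise; (2) $B^{(k)}_{j,\hat d}=\overline{C^{(k)}_{j,\hat d}}$ and $\mathcal{S}^{(k)}_{j,\hat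 d}=\mathrm{supp}(g_j)+\{\beta+\gamma:[B^{(k)}_{j,\hat d}]_{\beta\gamma}=1\}$. The supports of $B^{(k)}_{j,\hat d}$ are nondecreasing in $k$, so each sequence is eventually constant, with eventual value $B^{( * )}_{j,\hat d}$. Block relaxation $(\mathrm{Q}^k_{\hat d})$: minimize $L_{\mathbf{y}}(f)$ subject to $B^{(k)}_{0,\hat d}\circ M_{\hat d}(\mathbf{y})\succeq0$, $B^{(k)}_{j,\hat d}\circ M_{\hat d-d_j}(g_j\mathbf{y})\succeq0$ for $j=1,\ldots,m$, $y_{\mathbf{0}}=1$; optimal value $\theta^{(k)}_{\hat d}$. $(\mathrm{Q}^{\mathrm{ts}}_{\hat d})$ is the same problem with $B^{( * )}_{j,\hat d}$ in place of $B^{(k)}_{j,\hat d}$; optimal value $\theta^*_{\hat d}$. Optimal values lie in $\mathbb{R}\cup\{\pm\infty\}$. *)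

theory Defs
  imports "HOL-Analysis.Analysis" "HOL-Library.Poly_Mapping" "HOL-Library.Set_Algebras"
begin

text \<open>
  Exponents are vectors in \<open>nat ^ 'n\<close>, with \<open>n = CARD('n)\<close>, and the polynomial ring in \<open>n\<close>
  variables over the reals is the monoid algebra of \<open>nat ^ 'n\<close>; the support of a polynomial is
  its set of keys.
\<close>

type_synonym 'n exponent = "nat ^ 'n"
type_synonym 'n rpoly = "(nat ^ 'n) \<Rightarrow>\<^sub>0 real"

definition total_deg :: "'n::finite exponent \<Rightarrow> nat" where
  "total_deg \<alpha> = (\<Sum>i\<in>UNIV. \<alpha> $ i)"

definition exponents_upto :: "nat \<Rightarrow> 'n::finite exponent set" where
  "exponents_upto t = {\<alpha>. total_deg \<alpha> \<le> t}"

definition even_exponents :: "'n::finite exponent set" where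
  "even_exponents = {\<alpha>. \<forall>i. even (\<alpha> $ i)}"

abbreviation supp :: "'n::finite rpoly \<Rightarrow> 'n exponent set" where
  "supp h \<equiv> Poly_Mapping.keys h"

text \<open>The zero polynomial gets degree 0.\<close>

definition poly_deg :: "'n::finite rpoly \<Rightarrow> nat" where
  "poly_deg h = Max (insert 0 (total_deg ` supp h))"

definition half_deg :: "'n::finite rpoly \<Rightarrow> nat" where
  "half_deg h = nat \<lceil>real (poly_deg h) / 2\<rceil>"

text \<open>
  The constraints are \<open>g 1, \<dots>, g m\<close>; the value \<open>g 0\<close> of the given family is never used, since
  \<open>constr\<close> and \<open>hdeg\<close> install the conventions \<open>g\<^sub>0 = 1\<close> and \<open>d\<^sub>0 = 0\<close>.
\<close>

definition constr :: "(nat \<Rightarrow> 'n::finite rpoly) \<Rightarrow> nat \<Rightarrow> 'n rpoly" where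
  "constr g j = (if j = 0 then 1 else g j)"

definition hdeg :: "(nat \<Rightarrow> 'n::finite rpoly) \<Rightarrow> nat \<Rightarrow> nat" where
  "hdeg g j = (if j = 0 then 0 else half_deg (g j))"

definition min_order :: "'n::finite rpoly \<Rightarrow> (nat \<Rightarrow> 'n rpoly) \<Rightarrow> nat \<Rightarrow> nat" where
  "min_order f g m = Max (insert (half_deg f) (hdeg g ` {1..m}))"

definition riesz :: "('n::finite exponent \<Rightarrow> real) \<Rightarrow> 'n rpoly \<Rightarrow> real" where
  "riesz y h = (\<Sum>\<alpha>\<in>supp h. Poly_Mapping.lookup h \<alpha> * y \<alpha>)"

text \<open>
  Matrices indexed by a finite set of exponents are functions of two exponents. The entries of
  localizing matrices do not depend on the truncation order, so the index set is supplied only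
  where the matrix is required to be positive semidefinite. Binary matrices, which are compared
  as functions, vanish outside their index set.
\<close>

definition loc_matrix ::
  "'n::finite rpoly \<Rightarrow> ('n exponent \<Rightarrow> real) \<Rightarrow> 'n exponent \<Rightarrow> 'n exponent \<Rightarrow> real" where
  "loc_matrix h y \<beta> \<gamma> = (\<Sum>\<alpha>\<in>supp h. Poly_Mapping.lookup h \<alpha> * y (\<alpha> + \<beta> + \<gamma>))"

definition hadamard :: "('a \<Rightarrow> 'a \<Rightarrow> real) \<Rightarrow> ('a \<Rightarrow> 'a \<Rightarrow> real) \<Rightarrow> 'a \<Rightarrow> 'a \<Rightarrow> real" where
  "hadamard B M = (\<lambda>i j. B i j * M i j)"

definition psd_on :: "'a set \<Rightarrow> ('a \<Rightarrow> 'a \<Rightarrow> real) \<Rightarrow> bool" where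
  "psd_on I M \<longleftrightarrow> (\<forall>i\<in>I. \<forall>j\<in>I. M i j = M j i) \<and>
     (\<forall>v :: 'a \<Rightarrow> real. (\<Sum>i\<in>I. \<Sum>j\<in>I. v i * M i j * v j) \<ge> 0)"

definition dense_feasible ::
  "(nat \<Rightarrow> 'n::finite rpoly) \<Rightarrow> nat \<Rightarrow> nat \<Rightarrow> ('n exponent \<Rightarrow> real) set" where
  "dense_feasible g m dh =
     {y. (\<forall>j\<in>{0..m}. psd_on (exponents_upto (dh - hdeg g j)) (loc_matrix (constr g j) y)) \<and> y 0 = 1}"

definition dense_value :: "'n::finite rpoly \<Rightarrow> (nat \<Rightarrow> 'n rpoly) \<Rightarrow> nat \<Rightarrow> nat \<Rightarrow> ereal" where
  "dense_value f g m dh = (INF y \<in> dense_feasible g m dh. ereal (riesz y f))"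

definition block_closure :: "('a \<Rightarrow> 'a \<Rightarrow> real) \<Rightarrow> 'a \<Rightarrow> 'a \<Rightarrow> real" where
  "block_closure B = (\<lambda>i j. of_bool ((i, j) \<in> {(i, j). B i j = 1}\<^sup>+))"

text \<open>
  \<open>term_C g m dh S j\<close> is the matrix \<open>C\<^sub>j\<close> built from the supports \<open>S 0, \<dots>, S m\<close> of the
  previous iteration.
\<close>

definition term_C ::
  "(nat \<Rightarrow> 'n::finite rpoly) \<Rightarrow> nat \<Rightarrow> nat \<Rightarrow> (nat \<Rightarrow> 'n exponent set) \<Rightarrow> nat \<Rightarrow>
     'n exponent \<Rightarrow> 'n exponent \<Rightarrow> real" where
  "term_C g m dh S j = (\<lambda>\<beta> \<gamma>. of_bool
     (\<beta> \<in> exponents_upto (dh - hdeg g j) \<and> \<gamma> \<in> exponents_upto (dh - hdeg g j) \<and>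
      (supp (constr g j) + {\<beta>} + {\<gamma>}) \<inter> (\<Union>i\<in>{0..m}. S i) \<noteq> {}))"

primrec term_S ::
  "'n::finite rpoly \<Rightarrow> (nat \<Rightarrow> 'n rpoly) \<Rightarrow> nat \<Rightarrow> nat \<Rightarrow> nat \<Rightarrow> nat \<Rightarrow> 'n exponent set" where
  "term_S f g m dh 0 =
     (\<lambda>j. if j = 0 then supp f \<union> (\<Union>i\<in>{1..m}. supp (g i)) \<union> even_exponents else {})"
| "term_S f g m dh (Suc k) =
     (\<lambda>j. supp (constr g j) +
        {\<beta> + \<gamma> |\<beta> \<gamma>. block_closure (term_C g m dh (term_S f g m dh k) j) \<beta> \<gamma> = 1})"

text \<open>Only meaningful for \<open>k \<ge> 1\<close>.\<close>

definition term_B ::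
  "'n::finite rpoly \<Rightarrow> (nat \<Rightarrow> 'n rpoly) \<Rightarrow> nat \<Rightarrow> nat \<Rightarrow> nat \<Rightarrow> nat \<Rightarrow>
     'n exponent \<Rightarrow> 'n exponent \<Rightarrow> real" where
  "term_B f g m dh k j = block_closure (term_C g m dh (term_S f g m dh (k - 1)) j)"

definition eventual_value :: "(nat \<Rightarrow> 'a) \<Rightarrow> 'a" where
  "eventual_value X = (THE v. eventually (\<lambda>k. X k = v) sequentially)"

definition term_B_star ::
  "'n::finite rpoly \<Rightarrow> (nat \<Rightarrow> 'n rpoly) \<Rightarrow> nat \<Rightarrow> nat \<Rightarrow> nat \<Rightarrow>
     'n exponent \<Rightarrow> 'n exponent \<Rightarrow> real" where
  "term_B_star f g m dh j = eventual_value (\<lambda>k. term_B f g m dh k j)"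

definition masked_feasible ::
  "(nat \<Rightarrow> 'n::finite rpoly) \<Rightarrow> nat \<Rightarrow> nat \<Rightarrow> (nat \<Rightarrow> 'n exponent \<Rightarrow> 'n exponent \<Rightarrow> real) \<Rightarrow>
     ('n exponent \<Rightarrow> real) set" where
  "masked_feasible g m dh B =
     {y. (\<forall>j\<in>{0..m}. psd_on (exponents_upto (dh - hdeg g j))
            (hadamard (B j) (loc_matrix (constr g j) y))) \<and> y 0 = 1}"

definition block_value ::
  "'n::finite rpoly \<Rightarrow> (nat \<Rightarrow> 'n rpoly) \<Rightarrow> nat \<Rightarrow> nat \<Rightarrow> nat \<Rightarrow> ereal" where
  "block_value f g m dh k =
     (INF y \<in> masked_feasible g m dh (term_B f g m dh k). ereal (riesz y f))"

definition stable_value ::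
  "'n::finite rpoly \<Rightarrow> (nat \<Rightarrow> 'n rpoly) \<Rightarrow> nat \<Rightarrow> nat \<Rightarrow> ereal" where
  "stable_value f g m dh =
     (INF y \<in> masked_feasible g m dh (term_B_star f g m dh). ereal (riesz y f))"

end

theory Submission
  imports Defs
begin

text \<open>
  The binary matrices are indicators of partial equivalence relations, so masking a positive
  semidefinite matrix splits it into diagonal blocks and keeps it positive semidefinite. As the
  masks grow with \<open>k\<close>, the feasible sets shrink and the optimal values increase. Once the masks
  have stabilized, setting to zero all \<open>y \<alpha>\<close> with \<open>\<alpha>\<close> outside the stable support turns a feasible
  point of the block relaxation into one of the dense relaxation with the same objective value:
  its dense localizing matrices are exactly the masked localizing matrices of \<open>y\<close>.
\<close>

section \<open>Block closures and masking of positive semidefinite matrices\<close>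

lemma block_closure_eq_1_iff: "block_closure C i j = 1 \<longleftrightarrow> (i, j) \<in> {(i, j). C i j = 1}\<^sup>+"
  by (simp add: block_closure_def)

lemma block_closure_0_or_1: "block_closure C i j = 0 \<or> block_closure C i j = 1"
  by (simp add: block_closure_def)

lemma block_closure_eqI:
  assumes "\<And>i j. block_closure C i j = 1 \<longleftrightarrow> block_closure D i j = 1"
  shows "block_closure C = block_closure D"
  using assms block_closure_0_or_1 by (metis ext)

lemma block_closure_extensive: "C i j = 1 \<Longrightarrow> block_closure C i j = 1"
  by (auto simp: block_closure_eq_1_iff)

lemma block_closure_subset:
  assumes "\<And>i j. C i j = 1 \<Longrightarrow> i \<in> I \<and> j \<in> I" and "block_closure C i j = 1"
  shows "i \<in> I \<and> j \<in> I"
proof -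
  have "{(i, j). C i j = 1}\<^sup>+ \<subseteq> I \<times> I"
    using assms(1) by (intro trancl_subset_Sigma) auto
  then show ?thesis using assms(2) by (auto simp: block_closure_eq_1_iff)
qed

text \<open>An index unrelated to anything gives a zero row and column, and the other indices split
  into classes. So the masked quadratic form at \<open>v\<close> is the sum, over the classes, of
  the form of \<open>M\<close> at \<open>v\<close> restricted to the class.\<close>

lemma psd_on_hadamard_per:
  fixes R :: "'a rel"
  assumes fin: "finite I" and R: "sym R" "trans R" and M: "psd_on I M"
  shows "psd_on I (hadamard (\<lambda>i j. of_bool ((i, j) \<in> R)) M)"
proof -
  \<comment> \<open>The class of \<open>i\<close>, empty exactly when \<open>i\<close> is outside
    the domain of \<open>R\<close>; the empty class is therefore removed from the sums
    below.\<close>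
  define \<kappa> where "\<kappa> i = R `` {i}" for i
  have \<kappa>: "(i, j) \<in> R \<longleftrightarrow> \<kappa> i = \<kappa> j \<and> \<kappa> i \<noteq> {}" for i j
    using symD[OF R(1)] transD[OF R(2)] unfolding \<kappa>_def by blast
  have "(\<Sum>i\<in>I. \<Sum>j\<in>I. v i * hadamard (\<lambda>i j. of_bool ((i, j) \<in> R)) M i j * v j) \<ge> 0" for v
  proof -
    define w where "w c i = v i * of_bool (\<kappa> i = c)" for c i
    have split: "v i * hadamard (\<lambda>i j. of_bool ((i, j) \<in> R)) M i j * v j =
        (\<Sum>c\<in>\<kappa> ` I - {{}}. w c i * M i j * w c j)" if "i \<in> I" "j \<in> I" for i j
    proof -
      \<comment> \<open>\<open>w c i\<close> vanishes unless \<open>c\<close> is the class of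
        \<open>i\<close>, so at most one class contributes to each entry.\<close>
      have "(\<Sum>c\<in>\<kappa> ` I - {{}}. w c i * M i j * w c j) =
          (\<Sum>c\<in>\<kappa> ` I - {{}}. if c = \<kappa> i then v i * M i j * v j * of_bool (\<kappa> j = \<kappa> i) else 0)"
        by (intro sum.cong) (auto simp: w_def)
      also have "\<dots> = (if \<kappa> i \<in> \<kappa> ` I - {{}} then v i * M i j * v j * of_bool (\<kappa> j = \<kappa> i) else 0)"
        using fin by (subst sum.delta) auto
      also have "\<dots> = v i * hadamard (\<lambda>i j. of_bool ((i, j) \<in> R)) M i j * v j"
        using that by (auto simp: hadamard_def \<kappa>)
      finally show ?thesis by simp
    qed
    have "(\<Sum>i\<in>I. \<Sum>j\<in>I. v i * hadamard (\<lambda>i j. of_bool ((i, j) \<in> R)) M i j * v j) =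
        (\<Sum>i\<in>I. \<Sum>j\<in>I. \<Sum>c\<in>\<kappa> ` I - {{}}. w c i * M i j * w c j)"
      by (intro sum.cong refl split)
    also have "\<dots> = (\<Sum>i\<in>I. \<Sum>c\<in>\<kappa> ` I - {{}}. \<Sum>j\<in>I. w c i * M i j * w c j)"
      by (intro sum.cong refl sum.swap)
    also have "\<dots> = (\<Sum>c\<in>\<kappa> ` I - {{}}. \<Sum>i\<in>I. \<Sum>j\<in>I. w c i * M i j * w c j)"
      by (rule sum.swap)
    also have "\<dots> \<ge> 0"
      using M by (intro sum_nonneg[of "\<kappa> ` I - {{}}"]) (simp add: psd_on_def)
    finally show ?thesis .
  qed
  moreover have "hadamard (\<lambda>i j. of_bool ((i, j) \<in> R)) M i j =
      hadamard (\<lambda>i j. of_bool ((i, j) \<in> R)) M j i" if "i \<in> I" "j \<in> I" for i j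
    using that M symD[OF R(1)] by (auto simp: hadamard_def psd_on_def)
  ultimately show ?thesis by (simp add: psd_on_def)
qed

lemma psd_on_hadamard_block_closure:
  assumes "finite I" "\<And>i j. C i j = C j i" "psd_on I M"
  shows "psd_on I (hadamard (block_closure C) M)"
proof -
  have "sym ({(i, j). C i j = 1}\<^sup>+)"
    using assms(2) by (intro sym_trancl) (simp add: sym_def)
  then show ?thesis
    unfolding block_closure_def using assms(1,3) by (intro psd_on_hadamard_per) auto
qed

text \<open>The smaller mask absorbs the larger one: applied after it, it gives the same matrix as
  when applied alone, and this second masking preserves semidefiniteness.\<close>

lemma psd_on_hadamard_block_closure_mono:
  assumes "finite I" "\<And>i j. C i j = C j i"
    and "\<And>i j. block_closure C i j = 1 \<Longrightarrow> block_closure D i j = 1"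
    and "psd_on I (hadamard (block_closure D) M)"
  shows "psd_on I (hadamard (block_closure C) M)"
proof -
  have "hadamard (block_closure C) (hadamard (block_closure D) M) = hadamard (block_closure C) M"
    using assms(3) block_closure_0_or_1[of C] by (fastforce simp: hadamard_def fun_eq_iff)
  then show ?thesis
    using psd_on_hadamard_block_closure[of I C, OF assms(1,2,4)] by simp
qed

section \<open>Exponents of bounded degree\<close>

lemma finite_exponents_upto: "finite (exponents_upto t :: 'n::finite exponent set)"
proof (rule finite_subset)
  show "exponents_upto t \<subseteq> vec_lambda ` (UNIV \<rightarrow>\<^sub>E {..t} :: ('n \<Rightarrow> nat) set)"
  proof
    fix \<alpha> :: "'n exponent" assume "\<alpha> \<in> exponents_upto t"
    then have "\<alpha> $ i \<le> t" for i
      using member_le_sum[of i UNIV "($) \<alpha>"] by (simp add: exponents_upto_def total_deg_def)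
    then show "\<alpha> \<in> vec_lambda ` (UNIV \<rightarrow>\<^sub>E {..t})"
      by (intro image_eqI[of _ _ "($) \<alpha>"]) auto
  qed
qed (simp add: finite_PiE)

text \<open>Units of \<open>\<alpha>\<close> are moved into \<open>\<beta>\<close> one at a time
  until \<open>s\<close> have been moved or none is left. With \<open>s = t = dh\<close>, every
  exponent of degree at most \<open>2 * dh\<close> becomes the sum of a row and a column index of
  the moment matrix.\<close>

lemma total_deg_split:
  fixes \<alpha> :: "'n::finite exponent"
  assumes "total_deg \<alpha> \<le> s + t"
  obtains \<beta> \<gamma> where "\<alpha> = \<beta> + \<gamma>" "total_deg \<beta> \<le> s" "total_deg \<gamma> \<le> t"
proof -
  have "\<exists>\<beta> \<gamma>. \<alpha> = \<beta> + \<gamma> \<and> total_deg \<beta> \<le> s \<and> total_deg \<gamma> \<le> t"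
    using assms
  proof (induction s arbitrary: \<alpha>)
    case 0
    then show ?case by (intro exI[of _ 0] exI[of _ \<alpha>]) (simp add: total_deg_def)
  next
    case (Suc s)
    show ?case
    proof (cases "\<alpha> = 0")
      case True
      then show ?thesis by (intro exI[of _ 0]) (simp add: total_deg_def)
    next
      case False
      then obtain i where i: "\<alpha> $ i > 0" by (auto simp: vec_eq_iff)
      define \<epsilon> :: "'n exponent" where "\<epsilon> = axis i 1"
      define \<alpha>' where "\<alpha>' = \<alpha> - \<epsilon>"
      have \<alpha>: "\<alpha> = \<alpha>' + \<epsilon>"
        using i by (auto simp: vec_eq_iff \<alpha>'_def \<epsilon>_def axis_def)
      have add: "total_deg (\<delta> + \<epsilon>) = Suc (total_deg \<delta>)" for \<delta>
        by (simp add: total_deg_def \<epsilon>_def axis_def sum.distrib)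
      have "total_deg \<alpha>' \<le> s + t" using Suc.prems by (simp add: \<alpha> add)
      from Suc.IH[OF this] obtain \<beta> \<gamma>
        where "\<alpha>' = \<beta> + \<gamma>" "total_deg \<beta> \<le> s" "total_deg \<gamma> \<le> t" by blast
      then show ?thesis
        by (intro exI[of _ "\<beta> + \<epsilon>"] exI[of _ \<gamma>]) (simp add: \<alpha> add ac_simps)
    qed
  qed
  then show ?thesis using that by blast
qed

lemma total_deg_le_2_half_deg:
  assumes "\<alpha> \<in> supp h"
  shows "total_deg \<alpha> \<le> 2 * half_deg h"
proof -
  have "total_deg \<alpha> \<le> poly_deg h"
    unfolding poly_deg_def using assms by (intro Max_ge) auto
  moreover have "poly_deg h \<le> 2 * half_deg h"
    unfolding half_deg_def by linarith
  ultimately show ?thesis by simp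
qed

section \<open>Symmetry, supports and growth of the iterated binary matrices\<close>

lemma term_C_eq_1_iff:
  fixes g :: "nat \<Rightarrow> 'n::finite rpoly"
  shows
  "term_C g m dh S j \<beta> \<gamma> = 1 \<longleftrightarrow>
     \<beta> \<in> exponents_upto (dh - hdeg g j) \<and> \<gamma> \<in> exponents_upto (dh - hdeg g j) \<and>
     (\<exists>\<alpha>\<in>supp (constr g j). \<exists>i\<le>m. \<alpha> + \<beta> + \<gamma> \<in> S i)"
proof -
  have "supp (constr g j) + {\<beta>} + {\<gamma>} = (\<lambda>\<alpha>. \<alpha> + \<beta> + \<gamma>) ` supp (constr g j)"
    by (auto simp: set_plus_def)
  moreover have "A \<inter> B \<noteq> {} \<longleftrightarrow> (\<exists>\<alpha>\<in>A. \<alpha> \<in> B)" for A B :: "'n exponent set"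
    by blast
  ultimately show ?thesis by (simp add: term_C_def Bex_def)
qed

lemma term_C_sym: "term_C g m dh S j \<beta> \<gamma> = term_C g m dh S j \<gamma> \<beta>"
proof -
  have "supp (constr g j) + {\<beta>} + {\<gamma>} = supp (constr g j) + {\<gamma>} + {\<beta>}"
    by (simp add: ac_simps)
  then show ?thesis by (simp add: term_C_def conj_ac)
qed

lemma term_B_Suc:
  "term_B f g m dh (Suc k) j = block_closure (term_C g m dh (term_S f g m dh k) j)"
  by (simp add: term_B_def)

lemma term_S_Suc_iff:
  "\<alpha> \<in> term_S f g m dh (Suc k) j \<longleftrightarrow>
     (\<exists>\<delta>\<in>supp (constr g j). \<exists>\<beta> \<gamma>. term_B f g m dh (Suc k) j \<beta> \<gamma> = 1 \<and> \<alpha> = \<delta> + \<beta> + \<gamma>)"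
  by (auto simp: set_plus_def term_B_Suc add.assoc)

lemma term_B_subset:
  assumes "term_B f g m dh k j \<beta> \<gamma> = 1"
  shows "\<beta> \<in> exponents_upto (dh - hdeg g j) \<and> \<gamma> \<in> exponents_upto (dh - hdeg g j)"
  by (rule block_closure_subset[OF _ assms[unfolded term_B_def]]) (simp add: term_C_eq_1_iff)

text \<open>A zero constraint polynomial makes \<open>term_C\<close> vanish, and the closure of the
  empty relation is empty. This supplies the exponent \<open>\<delta>\<close> in
  \<open>term_B_step\<close>.\<close>

lemma term_B_supp_nonempty:
  assumes "term_B f g m dh k j \<beta> \<gamma> = 1"
  shows "supp (constr g j) \<noteq> {}"
proof
  assume "supp (constr g j) = {}"
  then have "{(\<beta>, \<gamma>). term_C g m dh (term_S f g m dh (k - 1)) j \<beta> \<gamma> = 1} = {}"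
    by (auto simp: term_C_eq_1_iff)
  with assms show False by (simp add: term_B_def block_closure_eq_1_iff)
qed

text \<open>A position of the mask puts \<open>\<delta> + \<beta> + \<gamma>\<close> into the
  support of the same stage, so at the next stage \<open>term_C\<close> has a 1 at this position
  even before closure.\<close>

lemma term_B_step:
  assumes "j \<le> m" "k \<ge> 1" and B: "term_B f g m dh k j \<beta> \<gamma> = 1"
  shows "term_B f g m dh (Suc k) j \<beta> \<gamma> = 1"
proof -
  obtain l where l: "k = Suc l" using assms(2) by (cases k) auto
  obtain \<delta> where "\<delta> \<in> supp (constr g j)" using term_B_supp_nonempty[OF B] by blast
  moreover from this B have "\<delta> + \<beta> + \<gamma> \<in> term_S f g m dh k j"
    unfolding l term_S_Suc_iff by blast
  ultimately have "term_C g m dh (term_S f g m dh k) j \<beta> \<gamma> = 1"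
    using term_B_subset[OF B] assms(1) unfolding term_C_eq_1_iff by blast
  then show ?thesis unfolding term_B_Suc by (rule block_closure_extensive)
qed

lemma term_B_mono:
  assumes "j \<le> m" "1 \<le> k" "k \<le> l" "term_B f g m dh k j \<beta> \<gamma> = 1"
  shows "term_B f g m dh l j \<beta> \<gamma> = 1"
  using assms(3,4)
proof (induction l rule: dec_induct)
  case (step l)
  then show ?case using assms(1,2) by (intro term_B_step) auto
qed

section \<open>Monotone optimal values and stabilization\<close>

lemma block_value_mono:
  assumes "1 \<le> k" "k \<le> l"
  shows "block_value f g m dh k \<le> block_value f g m dh l"
proof -
  have "psd_on (exponents_upto (dh - hdeg g j))
      (hadamard (term_B f g m dh k j) (loc_matrix (constr g j) y))"
    if "j \<le> m" and "psd_on (exponents_upto (dh - hdeg g j))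
      (hadamard (term_B f g m dh l j) (loc_matrix (constr g j) y))" for j y
    unfolding term_B_def
    by (rule psd_on_hadamard_block_closure_mono[OF finite_exponents_upto term_C_sym _
          that(2)[unfolded term_B_def]])
      (use term_B_mono[OF that(1) assms] in \<open>simp add: term_B_def\<close>)
  then have "masked_feasible g m dh (term_B f g m dh l) \<subseteq> masked_feasible g m dh (term_B f g m dh k)"
    by (auto simp: masked_feasible_def)
  \<comment> \<open>Shrinking the feasible set can only raise the infimum; in \<open>ereal\<close>
    an empty feasible set has value infinity, so infeasible relaxations are covered.\<close>
  then show ?thesis
    unfolding block_value_def by (rule INF_superset_mono) simp
qed

text \<open>To get one \<open>N\<close> for all \<open>j\<close>, the positions of all masks of a
  stage are collected in a single set \<open>A k\<close>, which grows with \<open>k \<ge> 1\<close>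
  inside the finite set \<open>U\<close>.\<close>

lemma term_B_star_stable:
  fixes f :: "'n::finite rpoly"
  obtains N where "N \<ge> 1"
    "\<And>k j. k \<ge> N \<Longrightarrow> j \<le> m \<Longrightarrow> term_B f g m dh k j = term_B_star f g m dh j"
proof -
  define A where "A k = (SIGMA j:{..m}. {(\<beta>, \<gamma>). term_B f g m dh k j \<beta> \<gamma> = 1})" for k
  define E :: "nat \<Rightarrow> 'n exponent set" where "E j = exponents_upto (dh - hdeg g j)" for j
  define U where "U = (SIGMA j:{..m}. E j \<times> E j)"
  have "finite U" by (auto simp: U_def E_def finite_exponents_upto)
  have AU: "A k \<subseteq> U" for k using term_B_subset unfolding A_def U_def E_def by fastforce
  then have finA: "finite (A k)" for k using \<open>finite U\<close> finite_subset by blast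
  \<comment> \<open>\<open>N\<close> maximizes the cardinality of \<open>A\<close>; each later
    \<open>A k\<close> contains \<open>A N\<close> and has no more elements, hence equals
    it.\<close>
  have "\<exists>N. 1 \<le> N \<and> (\<forall>k. 1 \<le> k \<longrightarrow> card (A k) \<le> card (A N))"
    by (rule ex_has_greatest_nat[where k = 1 and b = "Suc (card U)"])
      (use card_mono[OF \<open>finite U\<close> AU] in \<open>auto simp: less_Suc_eq_le\<close>)
  then obtain N where N: "N \<ge> 1" "\<And>k. 1 \<le> k \<Longrightarrow> card (A k) \<le> card (A N)" by blast
  have AN: "A k = A N" if "k \<ge> N" for k
  proof (rule card_seteq[symmetric, OF finA])
    show "A N \<subseteq> A k" using term_B_mono[OF _ N(1) that] by (auto simp: A_def)
    show "card (A k) \<le> card (A N)" using N that by simp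
  qed
  then have const: "term_B f g m dh k j = term_B f g m dh N j" if "k \<ge> N" "j \<le> m" for k j
    unfolding term_B_def
  proof (intro block_closure_eqI, fold term_B_def)
    fix \<beta> \<gamma>
    have "(j, \<beta>, \<gamma>) \<in> A k \<longleftrightarrow> (j, \<beta>, \<gamma>) \<in> A N"
      using AN[OF \<open>k \<ge> N\<close>] by simp
    then show "term_B f g m dh k j \<beta> \<gamma> = 1 \<longleftrightarrow> term_B f g m dh N j \<beta> \<gamma> = 1"
      using that by (simp add: A_def)
  qed
  have star: "term_B_star f g m dh j = term_B f g m dh N j" if "j \<le> m" for j
    unfolding term_B_star_def eventual_value_def
  proof (rule the_equality)
    show ev: "\<forall>\<^sub>F k in sequentially. term_B f g m dh k j = term_B f g m dh N j"
      using const[OF _ that] eventually_ge_at_top[of N] by (rule eventually_mono[rotated])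
    fix v assume "\<forall>\<^sub>F k in sequentially. term_B f g m dh k j = v"
    \<comment> \<open>Both eventual values are attained at a common index, as
      \<open>sequentially\<close> is a nontrivial filter; this is the uniqueness that
      \<open>THE\<close> requires.\<close>
    with ev have "\<forall>\<^sub>F k::nat in sequentially. v = term_B f g m dh N j"
      by eventually_elim simp
    then show "v = term_B f g m dh N j" by simp
  qed
  show ?thesis
  proof (rule that[OF N(1)])
    show "term_B f g m dh k j = term_B_star f g m dh j" if "k \<ge> N" "j \<le> m" for k j
      using const[OF that] star[OF that(2)] by simp
  qed
qed

section \<open>Comparison with the dense relaxation\<close>

lemma stable_le_dense: "stable_value f g m dh \<le> dense_value f g m dh"
proof -
  \<comment> \<open>The stable mask is the mask of some stage, hence the block closure of a
    symmetric matrix, so masking keeps dense feasible points feasible.\<close>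
  obtain N where N: "\<And>j. j \<le> m \<Longrightarrow> term_B f g m dh N j = term_B_star f g m dh j"
    using term_B_star_stable by (metis order_refl)
  have "psd_on (exponents_upto (dh - hdeg g j))
      (hadamard (term_B_star f g m dh j) (loc_matrix (constr g j) y))"
    if "j \<le> m" and "psd_on (exponents_upto (dh - hdeg g j)) (loc_matrix (constr g j) y)" for j y
    unfolding N[OF that(1), symmetric] term_B_def
    by (rule psd_on_hadamard_block_closure[OF finite_exponents_upto term_C_sym that(2)])
  then have "dense_feasible g m dh \<subseteq> masked_feasible g m dh (term_B_star f g m dh)"
    by (auto simp: dense_feasible_def masked_feasible_def)
  then show ?thesis
    unfolding stable_value_def dense_value_def by (rule INF_superset_mono) simp
qed

text \<open>Since \<open>constr g 0 = 1\<close>, a splitting of \<open>\<alpha>\<close> into two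
  moment matrix indices is a position of the first mask for \<open>j = 0\<close>. It persists in all
  later masks and returns \<open>\<alpha>\<close> to each support.\<close>

lemma term_S_initial_subset:
  assumes "\<alpha> \<in> term_S f g m dh 0 0" "total_deg \<alpha> \<le> 2 * dh" "k \<ge> 1"
  shows "\<alpha> \<in> term_S f g m dh k 0"
proof -
  obtain \<beta> \<gamma> where \<alpha>: "\<alpha> = \<beta> + \<gamma>" and "total_deg \<beta> \<le> dh" "total_deg \<gamma> \<le> dh"
    using total_deg_split[of \<alpha> dh dh] assms(2) by auto
  then have "\<beta> \<in> exponents_upto (dh - hdeg g 0)" "\<gamma> \<in> exponents_upto (dh - hdeg g 0)"
    by (auto simp: exponents_upto_def hdeg_def)
  then have "term_C g m dh (term_S f g m dh 0) 0 \<beta> \<gamma> = 1"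
    unfolding term_C_eq_1_iff using assms(1) by (auto simp: constr_def \<alpha>)
  then have "term_B f g m dh (Suc 0) 0 \<beta> \<gamma> = 1"
    unfolding term_B_Suc by (rule block_closure_extensive)
  with assms(3) have "term_B f g m dh k 0 \<beta> \<gamma> = 1"
    by (intro term_B_mono[where k = "Suc 0" and l = k]) auto
  then show ?thesis
    using assms(3) term_S_Suc_iff[of \<alpha> f g m dh "k - 1" 0] by (auto simp: constr_def \<alpha>)
qed

lemma dense_le_stable:
  fixes f :: "'n::finite rpoly"
  assumes "half_deg f \<le> dh"
  shows "dense_value f g m dh \<le> stable_value f g m dh"
  unfolding stable_value_def
proof (rule INF_greatest)
  fix y assume y: "y \<in> masked_feasible g m dh (term_B_star f g m dh)"
  obtain N where N: "N \<ge> 1"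
    "\<And>k j. k \<ge> N \<Longrightarrow> j \<le> m \<Longrightarrow> term_B f g m dh k j = term_B_star f g m dh j"
    using term_B_star_stable by metis
  then obtain l where l: "N = Suc l" by (cases N) auto
  define T where "T = (\<Union>i\<le>m. term_S f g m dh N i)"
  define y' where "y' \<alpha> = (if \<alpha> \<in> T then y \<alpha> else 0)" for \<alpha>
  have initial: "\<alpha> \<in> T" if "\<alpha> \<in> term_S f g m dh 0 0" "total_deg \<alpha> \<le> 2 * dh" for \<alpha>
    using term_S_initial_subset[OF that N(1)] unfolding T_def by blast
  have "loc_matrix (constr g j) y' \<beta> \<gamma> =
      hadamard (term_B_star f g m dh j) (loc_matrix (constr g j) y) \<beta> \<gamma>"
    if j: "j \<le> m" and \<beta>\<gamma>: "\<beta> \<in> exponents_upto (dh - hdeg g j)" "\<gamma> \<in> exponents_upto (dh - hdeg g j)"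
    for j \<beta> \<gamma>
  proof (cases "term_B f g m dh N j \<beta> \<gamma> = 1")
    case True
    \<comment> \<open>At a position of the mask all exponents of the entry lie in the stable
      support, so \<open>y'\<close> and \<open>y\<close> agree on them.\<close>
    then have "\<alpha> + \<beta> + \<gamma> \<in> T" if "\<alpha> \<in> supp (constr g j)" for \<alpha>
      using that j unfolding T_def l UN_iff term_S_Suc_iff by blast
    then show ?thesis
      using True N(2)[OF order_refl j] by (simp add: hadamard_def loc_matrix_def y'_def)
  next
    case False
    \<comment> \<open>Stability is used here: the matrix \<open>term_C\<close> built from the
      supports of stage \<open>N\<close> closes to the mask of stage \<open>N + 1\<close>, which is
      still that of stage \<open>N\<close>. Off the mask the shifted support thus misses
      \<open>T\<close>, and the entry for \<open>y'\<close> is zero.\<close>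
    have "term_B f g m dh (Suc N) j = term_B f g m dh N j" using N(2) j by simp
    with False have "term_C g m dh (term_S f g m dh N) j \<beta> \<gamma> \<noteq> 1"
      using block_closure_extensive term_B_Suc by metis
    then have "\<alpha> + \<beta> + \<gamma> \<notin> T" if "\<alpha> \<in> supp (constr g j)" for \<alpha>
      using that \<beta>\<gamma> by (auto simp: term_C_eq_1_iff T_def)
    moreover have "term_B f g m dh N j \<beta> \<gamma> = 0"
      using False block_closure_0_or_1 unfolding term_B_def by metis
    ultimately show ?thesis
      using N(2)[OF order_refl j] by (simp add: hadamard_def loc_matrix_def y'_def)
  qed
  \<comment> \<open>Semidefiniteness only reads entries with both indices in the index set, where
    the two matrices agree.\<close>
  then have "psd_on (exponents_upto (dh - hdeg g j)) (loc_matrix (constr g j) y')" if "j \<le> m" for j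
    using y that by (simp add: masked_feasible_def psd_on_def)
  \<comment> \<open>The zero exponent is even and of degree 0, so it belongs to \<open>T\<close> and
    normalization survives.\<close>
  moreover have "y' 0 = 1"
    using initial[of 0] y
    by (simp add: y'_def masked_feasible_def even_exponents_def total_deg_def)
  ultimately have "y' \<in> dense_feasible g m dh"
    by (simp add: dense_feasible_def)
  moreover have "riesz y' f = riesz y f"
  proof -
    \<comment> \<open>The order bound places \<open>supp f\<close> in degree at most
      \<open>2 * dh\<close>, so truncation leaves the objective unchanged.\<close>
    have "\<alpha> \<in> T" if "\<alpha> \<in> supp f" for \<alpha>
      using total_deg_le_2_half_deg[OF that] assms that by (intro initial) auto
    then show ?thesis by (simp add: riesz_def y'_def)
  qed
  ultimately show "dense_value f g m dh \<le> ereal (riesz y f)"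
    unfolding dense_value_def by (metis INF_lower)
qed

theorem theorem5p1:
  fixes f :: "'n::finite rpoly" and g :: "nat \<Rightarrow> 'n rpoly" and m dh :: nat
  assumes "dh \<ge> min_order f g m"
  shows "mono_on {1..} (\<lambda>k. block_value f g m dh k) \<and>
         stable_value f g m dh = dense_value f g m dh"
proof
  show "mono_on {1..} (\<lambda>k. block_value f g m dh k)"
    by (intro mono_onI) (simp add: block_value_mono)
  have "half_deg f \<le> min_order f g m"
    unfolding min_order_def by (intro Max_ge) auto
  then show "stable_value f g m dh = dense_value f g m dh"
    using assms by (intro antisym stable_le_dense dense_le_stable) simp
qed

end
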